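(* Let $\mathcal{CS}$ be a constant specification for $\mathsf{LP}^{\mathsf{C}}_h$. For every formula $A$ of the language of $\mathsf{LP}_h$, if $\mathsf{LP}^{\mathsf{C}}_h(\mathcal{CS})\vdash A$, then $\mathsf{LP}_h(\mathcal{CS}^\times)\vdash A$.
   Context: Fix a number $h\ge 1$ of agents. Throughout, $i$ ranges over $\{1,\dots,h\}$, $*$ over $\{1,\dots,h,\mathsf{C}\}$, and $\circledast$ over $\{1,\dots,h,\mathsf{E},\mathsf{C}\}$. For each $\circledast$ let $\mathrm{Cons}_\circledast$ (proof constants) and $\mathrm{Var}_\circledast$ (proof variables) be countably infinite sets, all pairwise disjoint. Evidence terms $\mathrm{Tm}_1,\dots,\mathrm{Tm}_h,\mathrm{Tm}_{\mathsf{E}},\mathrm{Tm}_{\mathsf{C}}$ are defined by simultaneous induction: $\mathrm{Cons}_\circledast\cup\mathrm{Var}_\circledast\subseteq\mathrm{Tm}_\circledast$; if $t\in\mathrm{Tm}_i$ then $!_i t\in\mathrm{Tm}_i$; if $t,s\in\mathrm{Tm}_*$ then $t+_*s,\ t\cdot_* s\in\mathrm{Tm}_*$; if $t_1\in\mathrm{Tm}_1,\dots,t_h\in\mathrm{Tm}_h$ then $\langle t_1,\dots,t_h\rangle\in\mathrm{Tm}_{\mathsf{E}}$; if $t\in\mathrm{Tm}_{\mathsf{E}}$ then $\pi_i t\in\mathrm{Tm}_i$; if $t\in\mathrm{Tm}_{\mathsf{C}}$ then $\mathsf{hd}(t),\mathsf{tl}(t)\in\mathrm{Tm}_{\mathsf{E}}$;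 if $t\in\mathrm{Tm}_{\mathsf{C}}$ and $s\in\mathrm{Tm}_{\mathsf{E}}$ then $\mathsf{ind}(t,s)\in\mathrm{Tm}_{\mathsf{C}}$. Formulae are built from a countable set $\mathrm{Prop}$ of propositional variables using $\neg,\wedge,\vee,\to$ and the rule: if $A$ is a formula and $t\in\mathrm{Tm}_\circledast$ then $t{:}_\circledast A$ is a formula (indices on $!,+,\cdot$ omitted when clear). Axioms of $\mathsf{LP}^{\mathsf{C}}_h$ (all instances): (1) propositional tautologies; (2) $t{:}_*(A\to B)\to(s{:}_*A\to (t\cdot s){:}_*B)$; (3) $t{:}_*A\to(t+s){:}_*A$ and $s{:}_*A\to(t+s){:}_*A$; (4) $t{:}_iA\to A$; (5) $t{:}_iA\to (!t){:}_i\, t{:}_iA$; (6) $t_1{:}_1A\wedge\dots\wedge t_h{:}_hA\to\langle t_1,\dots,t_h\rangle{:}_{\mathsf{E}}A$; (7) $t{:}_{\mathsf{E}}A\to (\pi_it){:}_iA$; (8) $t{:}_{\mathsf{C}}A\to\mathsf{hd}(t){:}_{\mathsf{E}}A$ and $t{:}_{\mathsf{C}}A\to\mathsf{tl}(t){:}_{\mathsf{E}}\,t{:}_{\mathsf{C}}A$; (9) $A\wedge t{:}_{\mathsf{C}}(A\to s{:}_{\mathsf{E}}A)\to\mathsf{ind}(t,s){:}_{\mathsf{C}}A$. A constant specification $\mathcal{CS}$ for $\mathsf{LP}^{\mathsf{C}}_h$ is any set of formulae $c{:}_\circledast A$ with $c\in\mathrm{Cons}_\circledast$ and $A$ an axiom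 of $\mathsf{LP}^{\mathsf{C}}_h$. $\mathsf{LP}^{\mathsf{C}}_h(\mathcal{CS})$ is the Hilbert system with these axioms, modus ponens, and axiom necessitation (derive $c{:}_\circledast A$ whenever $c{:}_\circledast A\in\mathcal{CS}$). The language of $\mathsf{LP}_h$: terms are built only from $\mathrm{Cons}_i,\mathrm{Var}_i$ using $!_i,+_i,\cdot_i$ (no terms of $\mathrm{Tm}_{\mathsf{E}}$ or $\mathrm{Tm}_{\mathsf{C}}$, no tupling, projections, $\mathsf{hd},\mathsf{tl},\mathsf{ind}$), and formulae use only $t{:}_iA$ with such terms. Its axioms are (1) propositional tautologies and, for each agent $i$, (2) $t{:}_i(A\to B)\to(s{:}_iA\to (t\cdot s){:}_iB)$, (3) $t{:}_iA\to(t+s){:}_iA$, $s{:}_iA\to(t+s){:}_iA$, (4) $t{:}_iA\to A$, (5) $t{:}_iA\to(!t){:}_it{:}_iA$, all in the $\mathsf{LP}_h$ language. The translation ${}^\times$ from $\mathsf{LP}^{\mathsf{C}}_h$-formulae to $\mathsf{LP}_h$-formulae: $P^\times=P$ for $P\in\mathrm{Prop}$; ${}^\times$ commutes with propositional connectives; $(t{:}_\circledast A)^\times=A^\times$ if $t$ contains a subterm belonging to $\mathrm{Tm}_{\mathsf{E}}\cup\mathrm{Tm}_{\mathsf{C}}$ (including $t$ itself), and $(t{:}_\circledast A)^\times=t{:}_\circledast A^\times$ otherwise. $\mathcal{CS}^\times:=\{D^\times: D\in\mathcal{CS}\}$. $\mathsf{LP}_h(\mathcal{CS}^\times)$ is the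 Hilbert system with the $\mathsf{LP}_h$ axioms, modus ponens, and the rule deriving (from no premises) each formula $c{:}_iB\in\mathcal{CS}^\times$. *)

theory Defs
  imports Main "HOL-Library.Countable"
begin

datatype label = Agent nat | Everyone | Common

definition agent_labels :: "nat \<Rightarrow> label set" where
  "agent_labels h = Agent ` {1..h}"

text \<open>The range of the index \<open>*\<close> is \<open>star_labels\<close>, that of the circled star is \<open>labels\<close>.\<close>

definition star_labels :: "nat \<Rightarrow> label set" where
  "star_labels h = agent_labels h \<union> {Common}"

definition labels :: "nat \<Rightarrow> label set" where
  "labels h = agent_labels h \<union> {Everyone, Common}"

text \<open>Raw terms; the well-sorted ones are singled out by \<open>is_tm\<close>. Constants and variables carry
  their label, so the sets of constants and variables of the various labels are countably infinite
  and pairwise disjoint.\<close>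

datatype tm =
    Const label nat
  | Var label nat
  | Bang nat tm
  | Plus label tm tm
  | Times label tm tm
  | Tuple "tm list"
  | Proj nat tm
  | Hd tm
  | Tl tm
  | Ind tm tm

text \<open>\<open>is_tm h l t\<close>: the term \<open>t\<close> belongs to \<open>Tm\<^sub>l\<close> in the language with \<open>h\<close> agents.
  List positions start at 0 and agents at 1, whence the \<open>Suc\<close> in the rule for tuples.\<close>

inductive is_tm :: "nat \<Rightarrow> label \<Rightarrow> tm \<Rightarrow> bool" for h :: nat where
  tm_const: "l \<in> labels h \<Longrightarrow> is_tm h l (Const l n)"
| tm_var: "l \<in> labels h \<Longrightarrow> is_tm h l (Var l n)"
| tm_bang: "i \<in> {1..h} \<Longrightarrow> is_tm h (Agent i) t \<Longrightarrow> is_tm h (Agent i) (Bang i t)"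
| tm_plus: "l \<in> star_labels h \<Longrightarrow> is_tm h l t \<Longrightarrow> is_tm h l s \<Longrightarrow> is_tm h l (Plus l t s)"
| tm_times: "l \<in> star_labels h \<Longrightarrow> is_tm h l t \<Longrightarrow> is_tm h l s \<Longrightarrow> is_tm h l (Times l t s)"
| tm_tuple: "length ts = h \<Longrightarrow> \<forall>k<h. is_tm h (Agent (Suc k)) (ts ! k) \<Longrightarrow>
    is_tm h Everyone (Tuple ts)"
| tm_proj: "i \<in> {1..h} \<Longrightarrow> is_tm h Everyone t \<Longrightarrow> is_tm h (Agent i) (Proj i t)"
| tm_hd: "is_tm h Common t \<Longrightarrow> is_tm h Everyone (Hd t)"
| tm_tl: "is_tm h Common t \<Longrightarrow> is_tm h Everyone (Tl t)"
| tm_ind: "is_tm h Common t \<Longrightarrow> is_tm h Everyone s \<Longrightarrow> is_tm h Common (Ind t s)"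

fun subterms :: "tm \<Rightarrow> tm set" where
  "subterms (Const l n) = {Const l n}"
| "subterms (Var l n) = {Var l n}"
| "subterms (Bang i t) = insert (Bang i t) (subterms t)"
| "subterms (Plus l t s) = insert (Plus l t s) (subterms t \<union> subterms s)"
| "subterms (Times l t s) = insert (Times l t s) (subterms t \<union> subterms s)"
| "subterms (Tuple ts) = insert (Tuple ts) (\<Union>t\<in>set ts. subterms t)"
| "subterms (Proj i t) = insert (Proj i t) (subterms t)"
| "subterms (Hd t) = insert (Hd t) (subterms t)"
| "subterms (Tl t) = insert (Tl t) (subterms t)"
| "subterms (Ind t s) = insert (Ind t s) (subterms t \<union> subterms s)"

text \<open>\<open>Just l t A\<close> is the formula \<open>t :\<^sub>l A\<close>.\<close>

datatype 'p fm =
    Prop 'p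
  | Neg "'p fm" (\<open>\<^bold>\<not> _\<close> [70] 70)
  | Conj "'p fm" "'p fm" (infixr \<open>\<^bold>\<and>\<close> 65)
  | Disj "'p fm" "'p fm" (infixr \<open>\<^bold>\<or>\<close> 60)
  | Imp "'p fm" "'p fm" (infixr \<open>\<^bold>\<rightarrow>\<close> 55)
  | Just label tm "'p fm"

primrec is_fm :: "nat \<Rightarrow> 'p fm \<Rightarrow> bool" where
  "is_fm h (Prop p) \<longleftrightarrow> True"
| "is_fm h (\<^bold>\<not> A) \<longleftrightarrow> is_fm h A"
| "is_fm h (A \<^bold>\<and> B) \<longleftrightarrow> is_fm h A \<and> is_fm h B"
| "is_fm h (A \<^bold>\<or> B) \<longleftrightarrow> is_fm h A \<and> is_fm h B"
| "is_fm h (A \<^bold>\<rightarrow> B) \<longleftrightarrow> is_fm h A \<and> is_fm h B"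
| "is_fm h (Just l t A) \<longleftrightarrow> l \<in> labels h \<and> is_tm h l t \<and> is_fm h A"

text \<open>Propositional truth value, where propositional variables and formulae \<open>t :\<^sub>l A\<close> are both
  treated as atoms; \<open>v\<close> is only ever consulted on these.\<close>

primrec peval :: "('p fm \<Rightarrow> bool) \<Rightarrow> 'p fm \<Rightarrow> bool" where
  "peval v (Prop p) \<longleftrightarrow> v (Prop p)"
| "peval v (\<^bold>\<not> A) \<longleftrightarrow> \<not> peval v A"
| "peval v (A \<^bold>\<and> B) \<longleftrightarrow> peval v A \<and> peval v B"
| "peval v (A \<^bold>\<or> B) \<longleftrightarrow> peval v A \<or> peval v B"
| "peval v (A \<^bold>\<rightarrow> B) \<longleftrightarrow> (peval v A \<longrightarrow> peval v B)"
| "peval v (Just l t A) \<longleftrightarrow> v (Just l t A)"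

definition tautology :: "'p fm \<Rightarrow> bool" where
  "tautology A \<longleftrightarrow> (\<forall>v. peval v A)"

text \<open>Conjunction of a nonempty list, bracketed to the right; the value on the empty list is never
  used since there is at least one agent.\<close>

fun big_conj :: "'p fm list \<Rightarrow> 'p fm" where
  "big_conj [A] = A"
| "big_conj (A # B # As) = A \<^bold>\<and> big_conj (B # As)"
| "big_conj [] = undefined"

text \<open>The prefix \<open>lpc\<close> refers to the logic \<open>LP\<^sup>C\<close> with common knowledge, the prefix \<open>lp\<close> to
  the logic \<open>LP\<close>, whose language consists of the formulae satisfying \<open>is_lp_fm\<close>.\<close>

inductive lpc_schema :: "nat \<Rightarrow> 'p fm \<Rightarrow> bool" for h :: nat where
  lpc_taut: "tautology A \<Longrightarrow> lpc_schema h A"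
| lpc_app: "l \<in> star_labels h \<Longrightarrow>
    lpc_schema h (Just l t (A \<^bold>\<rightarrow> B) \<^bold>\<rightarrow> (Just l s A \<^bold>\<rightarrow> Just l (Times l t s) B))"
| lpc_sum_left: "l \<in> star_labels h \<Longrightarrow> lpc_schema h (Just l t A \<^bold>\<rightarrow> Just l (Plus l t s) A)"
| lpc_sum_right: "l \<in> star_labels h \<Longrightarrow> lpc_schema h (Just l s A \<^bold>\<rightarrow> Just l (Plus l t s) A)"
| lpc_refl: "i \<in> {1..h} \<Longrightarrow> lpc_schema h (Just (Agent i) t A \<^bold>\<rightarrow> A)"
| lpc_bang: "i \<in> {1..h} \<Longrightarrow>
    lpc_schema h (Just (Agent i) t A \<^bold>\<rightarrow> Just (Agent i) (Bang i t) (Just (Agent i) t A))"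
| lpc_tuple: "length ts = h \<Longrightarrow>
    lpc_schema h (big_conj (map (\<lambda>k. Just (Agent (Suc k)) (ts ! k) A) [0..<h]) \<^bold>\<rightarrow>
      Just Everyone (Tuple ts) A)"
| lpc_proj: "i \<in> {1..h} \<Longrightarrow> lpc_schema h (Just Everyone t A \<^bold>\<rightarrow> Just (Agent i) (Proj i t) A)"
| lpc_hd: "lpc_schema h (Just Common t A \<^bold>\<rightarrow> Just Everyone (Hd t) A)"
| lpc_tl: "lpc_schema h (Just Common t A \<^bold>\<rightarrow> Just Everyone (Tl t) (Just Common t A))"
| lpc_ind: "lpc_schema h
    (A \<^bold>\<and> Just Common t (A \<^bold>\<rightarrow> Just Everyone s A) \<^bold>\<rightarrow> Just Common (Ind t s) A)"

text \<open>The schemata range over raw terms; the axioms are their well-formed instances.\<close>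

definition lpc_axiom :: "nat \<Rightarrow> 'p fm \<Rightarrow> bool" where
  "lpc_axiom h A \<longleftrightarrow> is_fm h A \<and> lpc_schema h A"

definition constant_specification :: "nat \<Rightarrow> 'p fm set \<Rightarrow> bool" where
  "constant_specification h CS \<longleftrightarrow>
    (\<forall>D\<in>CS. \<exists>l\<in>labels h. \<exists>n A. D = Just l (Const l n) A \<and> lpc_axiom h A)"

inductive lpc_provable :: "nat \<Rightarrow> 'p fm set \<Rightarrow> 'p fm \<Rightarrow> bool"
  for h :: nat and CS :: "'p fm set" where
  lpc_ax: "lpc_axiom h A \<Longrightarrow> lpc_provable h CS A"
| lpc_mp: "lpc_provable h CS (A \<^bold>\<rightarrow> B) \<Longrightarrow> lpc_provable h CS A \<Longrightarrow> lpc_provable h CS B"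
| lpc_nec: "l \<in> labels h \<Longrightarrow> Just l (Const l n) A \<in> CS \<Longrightarrow> lpc_provable h CS (Just l (Const l n) A)"

inductive is_lp_tm :: "nat \<Rightarrow> nat \<Rightarrow> tm \<Rightarrow> bool" for h :: nat where
  lp_tm_const: "i \<in> {1..h} \<Longrightarrow> is_lp_tm h i (Const (Agent i) n)"
| lp_tm_var: "i \<in> {1..h} \<Longrightarrow> is_lp_tm h i (Var (Agent i) n)"
| lp_tm_bang: "is_lp_tm h i t \<Longrightarrow> is_lp_tm h i (Bang i t)"
| lp_tm_plus: "is_lp_tm h i t \<Longrightarrow> is_lp_tm h i s \<Longrightarrow> is_lp_tm h i (Plus (Agent i) t s)"
| lp_tm_times: "is_lp_tm h i t \<Longrightarrow> is_lp_tm h i s \<Longrightarrow> is_lp_tm h i (Times (Agent i) t s)"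

primrec is_lp_fm :: "nat \<Rightarrow> 'p fm \<Rightarrow> bool" where
  "is_lp_fm h (Prop p) \<longleftrightarrow> True"
| "is_lp_fm h (\<^bold>\<not> A) \<longleftrightarrow> is_lp_fm h A"
| "is_lp_fm h (A \<^bold>\<and> B) \<longleftrightarrow> is_lp_fm h A \<and> is_lp_fm h B"
| "is_lp_fm h (A \<^bold>\<or> B) \<longleftrightarrow> is_lp_fm h A \<and> is_lp_fm h B"
| "is_lp_fm h (A \<^bold>\<rightarrow> B) \<longleftrightarrow> is_lp_fm h A \<and> is_lp_fm h B"
| "is_lp_fm h (Just l t A) \<longleftrightarrow> (\<exists>i\<in>{1..h}. l = Agent i \<and> is_lp_tm h i t) \<and> is_lp_fm h A"

inductive lp_schema :: "nat \<Rightarrow> 'p fm \<Rightarrow> bool" for h :: nat where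
  lp_taut: "tautology A \<Longrightarrow> lp_schema h A"
| lp_app: "i \<in> {1..h} \<Longrightarrow>
    lp_schema h (Just (Agent i) t (A \<^bold>\<rightarrow> B) \<^bold>\<rightarrow>
      (Just (Agent i) s A \<^bold>\<rightarrow> Just (Agent i) (Times (Agent i) t s) B))"
| lp_sum_left: "i \<in> {1..h} \<Longrightarrow>
    lp_schema h (Just (Agent i) t A \<^bold>\<rightarrow> Just (Agent i) (Plus (Agent i) t s) A)"
| lp_sum_right: "i \<in> {1..h} \<Longrightarrow>
    lp_schema h (Just (Agent i) s A \<^bold>\<rightarrow> Just (Agent i) (Plus (Agent i) t s) A)"
| lp_refl: "i \<in> {1..h} \<Longrightarrow> lp_schema h (Just (Agent i) t A \<^bold>\<rightarrow> A)"
| lp_bang: "i \<in> {1..h} \<Longrightarrow>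
    lp_schema h (Just (Agent i) t A \<^bold>\<rightarrow> Just (Agent i) (Bang i t) (Just (Agent i) t A))"

definition lp_axiom :: "nat \<Rightarrow> 'p fm \<Rightarrow> bool" where
  "lp_axiom h A \<longleftrightarrow> is_lp_fm h A \<and> lp_schema h A"

text \<open>In \<open>lp_provable h X\<close> the set \<open>X\<close> is arbitrary, but only its members of the form
  \<open>c :\<^sub>i B\<close>, for an agent \<open>i\<close> and a constant \<open>c\<close> of that agent, are used.\<close>

inductive lp_provable :: "nat \<Rightarrow> 'p fm set \<Rightarrow> 'p fm \<Rightarrow> bool"
  for h :: nat and X :: "'p fm set" where
  lp_ax: "lp_axiom h A \<Longrightarrow> lp_provable h X A"
| lp_mp: "lp_provable h X (A \<^bold>\<rightarrow> B) \<Longrightarrow> lp_provable h X A \<Longrightarrow> lp_provable h X B"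
| lp_nec: "i \<in> {1..h} \<Longrightarrow> Just (Agent i) (Const (Agent i) n) B \<in> X \<Longrightarrow>
    lp_provable h X (Just (Agent i) (Const (Agent i) n) B)"

text \<open>\<open>cross h A\<close> is the translation \<open>A\<^sup>\<times>\<close> from the language of \<open>LP\<^sup>C\<close> to that of \<open>LP\<close>.\<close>

primrec cross :: "nat \<Rightarrow> 'p fm \<Rightarrow> 'p fm" where
  "cross h (Prop p) = Prop p"
| "cross h (\<^bold>\<not> A) = \<^bold>\<not> cross h A"
| "cross h (A \<^bold>\<and> B) = cross h A \<^bold>\<and> cross h B"
| "cross h (A \<^bold>\<or> B) = cross h A \<^bold>\<or> cross h B"
| "cross h (A \<^bold>\<rightarrow> B) = cross h A \<^bold>\<rightarrow> cross h B"
| "cross h (Just l t A) =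
    (if \<exists>u\<in>subterms t. is_tm h Everyone u \<or> is_tm h Common u
     then cross h A else Just l t (cross h A))"

end

(* The translation of every LP^C axiom is derivable in LP, so a derivation can be translated line by
   line; the translation fixes formulae of the LP language. An axiom whose evidence terms all
   survive is sent to an instance of the same LP axiom. If a term is erased, then t : A becomes A,
   and the resulting implication follows propositionally from reflection for the surviving terms.
   A member of CS whose constant has label E or C is sent to the translation of an axiom. *)
theory Submission
  imports Defs
begin

section \<open>Terms erased by the translation\<close>

definition erased :: "nat \<Rightarrow> tm \<Rightarrow> bool" where
  "erased h t \<longleftrightarrow> (\<exists>u\<in>subterms t. is_tm h Everyone u \<or> is_tm h Common u)"

inductive_simps is_tm_simps [simp]:
  "is_tm h l (Const l' n)"
  "is_tm h l (Var l' n)"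
  "is_tm h l (Bang i t)"
  "is_tm h l (Plus l' t s)"
  "is_tm h l (Times l' t s)"
  "is_tm h l (Tuple ts)"
  "is_tm h l (Proj i t)"
  "is_tm h l (Hd t)"
  "is_tm h l (Tl t)"
  "is_tm h l (Ind t s)"

lemma subterms_self [simp]: "t \<in> subterms t"
  by (cases t) auto

text \<open>Replaces the last defining equation of \<open>cross\<close> as a simp rule, so that
  simplification treats erasure as an atom and does not meet the quantifier over subterms.\<close>

lemma cross_Just: "cross h (Just l t A) = (if erased h t then cross h A else Just l t (cross h A))"
  by (simp add: erased_def)

declare cross.simps(6) [simp del]
declare cross_Just [simp]

lemma agent_mem_labels [simp]: "Agent i \<in> labels h \<longleftrightarrow> i \<in> {1..h}"
  by (auto simp: labels_def agent_labels_def)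

lemma erased_Everyone: "is_tm h Everyone t \<Longrightarrow> erased h t"
  and erased_Common: "is_tm h Common t \<Longrightarrow> erased h t"
  unfolding erased_def using subterms_self by blast+

text \<open>By inversion of \<open>is_tm\<close>, the head term itself can only have an agent sort,
  so only its proper subterms can cause erasure.\<close>

lemma erased_simps [simp]:
  "\<not> erased h (Const (Agent i) n)"
  "\<not> erased h (Var (Agent i) n)"
  "erased h (Bang i t) \<longleftrightarrow> erased h t"
  "erased h (Plus (Agent i) t s) \<longleftrightarrow> erased h t \<or> erased h s"
  "erased h (Times (Agent i) t s) \<longleftrightarrow> erased h t \<or> erased h s"
  by (auto simp: erased_def)

lemma erased_Proj: "is_tm h Everyone t \<Longrightarrow> erased h (Proj i t)"
  by (auto simp: erased_def intro: bexI [of _ t])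

text \<open>Of the rules that produce a term of agent sort, only projection leaves the
  \<open>LP\<close> language, and its argument has sort \<open>Everyone\<close>, which erases the
  term. The sort is a variable \<open>l\<close> tied to \<open>Agent i\<close> by an equation so
  that the rule induction applies.\<close>

lemma is_lp_tm_if_not_erased:
  "is_tm h l t \<Longrightarrow> l = Agent i \<Longrightarrow> \<not> erased h t \<Longrightarrow> is_lp_tm h i t"
  by (induction arbitrary: i rule: is_tm.induct)
    (auto simp: erased_Proj intro: is_lp_tm.intros)

lemma not_erased_if_is_lp_tm: "is_lp_tm h i t \<Longrightarrow> \<not> erased h t"
  by (induction rule: is_lp_tm.induct) auto

lemma label_cases:
  assumes "l \<in> labels h"
  obtains i where "i \<in> {1..h}" "l = Agent i" | "l = Everyone" | "l = Common"
  using assms by (auto simp: labels_def agent_labels_def)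

lemma star_label_cases:
  assumes "l \<in> star_labels h"
  obtains i where "i \<in> {1..h}" "l = Agent i" | "l = Common"
  using assms by (auto simp: star_labels_def agent_labels_def)

section \<open>The translation on formulae\<close>

lemma cross_is_lp_fm: "is_fm h A \<Longrightarrow> is_lp_fm h (cross h A)"
proof (induction A)
  case (Just l t A)
  then have "l \<in> labels h" by simp
  then show ?case
    by (cases rule: label_cases)
      (use Just in \<open>auto simp: erased_Everyone erased_Common intro: is_lp_tm_if_not_erased\<close>)
qed auto

lemma cross_id: "is_lp_fm h A \<Longrightarrow> cross h A = A"
  by (induction A) (auto dest: not_erased_if_is_lp_tm)

text \<open>Propositionally, \<open>cross\<close> acts as a substitution: it commutes with the
  connectives, so its effect can be absorbed into the valuation of the atoms \<open>Prop p\<close>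
  and \<open>Just l t A\<close>. Hence tautologies stay tautologies.\<close>

lemma peval_cross: "peval v (cross h A) = peval (\<lambda>B. peval v (cross h B)) A"
  by (induction A) auto

lemma tautology_cross: "tautology A \<Longrightarrow> tautology (cross h A)"
  unfolding tautology_def by (subst peval_cross) simp

section \<open>Propositional reasoning in \<open>LP\<close>\<close>

lemma lp_tautology: "is_lp_fm h A \<Longrightarrow> tautology A \<Longrightarrow> lp_provable h X A"
  by (simp add: lp_ax lp_axiom_def lp_taut)

lemma lp_tautological_consequence:
  assumes "lp_provable h X A" "is_lp_fm h A" "is_lp_fm h B"
    and "\<And>v. peval v A \<Longrightarrow> peval v B"
  shows "lp_provable h X B"
proof -
  have "lp_provable h X (A \<^bold>\<rightarrow> B)"
    using assms(2-4) by (intro lp_tautology) (auto simp: tautology_def)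
  then show ?thesis
    using assms(1) by (rule lp_mp)
qed

text \<open>Nonemptiness keeps \<open>big_conj []\<close>, which is \<open>undefined\<close>, out of
  the induction, here and in the next two lemmas.\<close>

lemma peval_big_conj: "As \<noteq> [] \<Longrightarrow> peval v (big_conj As) \<longleftrightarrow> (\<forall>A\<in>set As. peval v A)"
  by (induction As rule: big_conj.induct) auto

lemma is_fm_big_conj: "As \<noteq> [] \<Longrightarrow> is_fm h (big_conj As) \<longleftrightarrow> (\<forall>A\<in>set As. is_fm h A)"
  by (induction As rule: big_conj.induct) auto

lemma cross_big_conj: "As \<noteq> [] \<Longrightarrow> cross h (big_conj As) = big_conj (map (cross h) As)"
  by (induction As rule: big_conj.induct) auto

section \<open>Translated axioms\<close>

lemma lp_cross_refl:
  assumes "i \<in> {1..h}" "is_tm h (Agent i) t" "is_fm h A"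
  shows "lp_provable h X (cross h (Just (Agent i) t A \<^bold>\<rightarrow> A))"
proof (cases "erased h t")
  case True
  with assms show ?thesis
    by (auto intro!: lp_tautology simp: cross_is_lp_fm tautology_def)
next
  case False
  with assms show ?thesis
    by (auto intro!: lp_ax lp_refl simp: lp_axiom_def cross_is_lp_fm is_lp_tm_if_not_erased)
qed

lemma lp_cross_app:
  assumes i: "i \<in> {1..h}" and t: "is_tm h (Agent i) t" and s: "is_tm h (Agent i) s"
    and A: "is_fm h A" and B: "is_fm h B"
  shows "lp_provable h X (cross h (Just (Agent i) t (A \<^bold>\<rightarrow> B) \<^bold>\<rightarrow>
    (Just (Agent i) s A \<^bold>\<rightarrow> Just (Agent i) (Times (Agent i) t s) B)))" (is "lp_provable h X (cross h ?F)")
proof -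
  have "is_fm h ?F"
    using assms by (auto simp: star_labels_def agent_labels_def)
  then have F: "is_lp_fm h (cross h ?F)"
    by (rule cross_is_lp_fm)
  consider "erased h t" | "erased h s" | "\<not> erased h t" "\<not> erased h s"
    by blast
  then show ?thesis
  proof cases
    \<comment> \<open>The product is erased too, which leaves
      \<open>(A \<rightarrow> B) \<rightarrow> (s : A \<rightarrow> B)\<close> up to translation,
      with \<open>s : A\<close> replaced by \<open>A\<close> if \<open>s\<close> is erased as well.
      Reflection for \<open>s\<close> implies it.\<close>
    case 1
    then show ?thesis
      using F cross_is_lp_fm [of h "Just (Agent i) s A \<^bold>\<rightarrow> A"] assms
      by (intro lp_tautological_consequence [OF lp_cross_refl [OF i s A]]) auto
  next
    \<comment> \<open>The translated axiom now says that the translation of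
      \<open>t : (A \<rightarrow> B)\<close> implies that of \<open>A \<rightarrow> B\<close>, which
      is reflection for \<open>t\<close>.\<close>
    case 2
    then show ?thesis
      using F cross_is_lp_fm [of h "Just (Agent i) t (A \<^bold>\<rightarrow> B) \<^bold>\<rightarrow> (A \<^bold>\<rightarrow> B)"] assms
      by (intro lp_tautological_consequence [OF lp_cross_refl [OF i t, of "A \<^bold>\<rightarrow> B"]]) auto
  next
    case 3
    with F i show ?thesis
      by (auto intro!: lp_ax lp_app simp: lp_axiom_def)
  qed
qed

lemma lp_cross_sum:
  assumes i: "i \<in> {1..h}" and t: "is_tm h (Agent i) t" and s: "is_tm h (Agent i) s"
    and A: "is_fm h A"
  shows "lp_provable h X (cross h (Just (Agent i) t A \<^bold>\<rightarrow> Just (Agent i) (Plus (Agent i) t s) A))"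
    and "lp_provable h X (cross h (Just (Agent i) s A \<^bold>\<rightarrow> Just (Agent i) (Plus (Agent i) t s) A))"
proof -
  let ?F = "\<lambda>u. Just (Agent i) u A \<^bold>\<rightarrow> Just (Agent i) (Plus (Agent i) t s) A"
  have "lp_provable h X (cross h (?F u))" if u: "u = t \<or> u = s" for u
  proof (cases "erased h t \<or> erased h s")
    \<comment> \<open>The sum is erased as soon as one summand is, even if \<open>u\<close> is the
      other one and survives; what remains is the translated reflection for
      \<open>u\<close>.\<close>
    case True
    with u assms show ?thesis
      using lp_cross_refl [OF i _ A, of u] by (auto simp: if_distrib)
  next
    case False
    moreover have "is_fm h (?F u)"
      using u assms by (auto simp: star_labels_def agent_labels_def)
    then have "is_lp_fm h (cross h (?F u))"
      by (rule cross_is_lp_fm)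
    ultimately show ?thesis
      using u i by (auto intro!: lp_ax lp_sum_left lp_sum_right simp: lp_axiom_def)
  qed
  then show "lp_provable h X (cross h (?F t))" "lp_provable h X (cross h (?F s))"
    by simp_all
qed

text \<open>The tuple is erased, so the conclusion becomes \<open>cross h A\<close>; a single
  conjunct of the premise yields it by reflection.\<close>

lemma lp_cross_tuple:
  assumes h: "h \<ge> 1" and ts: "\<forall>k<h. is_tm h (Agent (Suc k)) (ts ! k)" and A: "is_fm h A"
    and len: "length ts = h"
  shows "lp_provable h X (cross h (big_conj (map (\<lambda>k. Just (Agent (Suc k)) (ts ! k) A) [0..<h])
    \<^bold>\<rightarrow> Just Everyone (Tuple ts) A))" (is "lp_provable h X (cross h (big_conj ?As \<^bold>\<rightarrow> _))")
proof -
  have ne: "?As \<noteq> []"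
    using h by auto
  have Everyone: "erased h (Tuple ts)" "Everyone \<in> labels h"
    using ts len by (auto intro: erased_Everyone simp: labels_def)
  \<comment> \<open>Agent 1 supplies the conjunct: it exists because \<open>h \<ge> 1\<close>, and
    its term sits at list position 0.\<close>
  have i: "1 \<in> {1..h}" and t: "is_tm h (Agent 1) (ts ! 0)"
    using h ts by auto
  have "is_fm h (big_conj ?As)"
    using ts A by (auto simp: is_fm_big_conj [OF ne])
  then have "is_lp_fm h (cross h (big_conj ?As))"
    by (rule cross_is_lp_fm)
  then have "is_lp_fm h (cross h (big_conj ?As \<^bold>\<rightarrow> Just Everyone (Tuple ts) A))"
    using A Everyone by (simp add: cross_is_lp_fm)
  moreover have "is_lp_fm h (cross h (Just (Agent 1) (ts ! 0) A \<^bold>\<rightarrow> A))"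
    using i t A by (intro cross_is_lp_fm) simp
  moreover have "peval v (cross h (big_conj ?As \<^bold>\<rightarrow> Just Everyone (Tuple ts) A))"
    if v: "peval v (cross h (Just (Agent 1) (ts ! 0) A \<^bold>\<rightarrow> A))" for v
  proof -
    have "peval v (cross h (Just (Agent 1) (ts ! 0) A))" if "peval v (cross h (big_conj ?As))"
    proof -
      have "Just (Agent 1) (ts ! 0) A \<in> set ?As"
        using h by force
      then have "cross h (Just (Agent 1) (ts ! 0) A) \<in> set (map (cross h) ?As)"
        unfolding set_map by (rule imageI)
      moreover have "\<forall>B\<in>set (map (cross h) ?As). peval v B"
        using that ne unfolding cross_big_conj [OF ne] by (subst (asm) peval_big_conj) blast+
      ultimately show ?thesis
        by blast
    qed
    then show ?thesis
      using v Everyone by simp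
  qed
  ultimately show ?thesis
    by (intro lp_tautological_consequence [OF lp_cross_refl [OF i t A]])
qed

lemma lp_provable_cross_axiom:
  assumes h: "h \<ge> 1" and ax: "lpc_axiom h F"
  shows "lp_provable h X (cross h F)"
proof -
  have fm: "is_fm h F" and "lpc_schema h F"
    using ax by (auto simp: lpc_axiom_def)
  from \<open>lpc_schema h F\<close> show ?thesis
  proof cases
    case lpc_taut
    then show ?thesis
      using fm by (simp add: lp_tautology tautology_cross cross_is_lp_fm)
  next
    case (lpc_app l t A B s)
    from \<open>l \<in> star_labels h\<close> show ?thesis
    proof (cases rule: star_label_cases)
      case (1 i)
      then show ?thesis
        using lp_cross_app [of i h t s A B] lpc_app fm by simp
    next
      \<comment> \<open>At label \<open>Common\<close> all three terms are erased, and both sides of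
        the axiom become the translation of \<open>A \<rightarrow> B\<close>.\<close>
      case 2
      then show ?thesis
        using fm lpc_app cross_is_lp_fm [OF fm]
        by (auto intro!: lp_tautology simp: erased_Common tautology_def)
    qed
  next
    case (lpc_sum_left l t A s)
    from \<open>l \<in> star_labels h\<close> show ?thesis
    proof (cases rule: star_label_cases)
      case (1 i)
      then show ?thesis
        using lp_cross_sum(1) [of i h t s A] lpc_sum_left fm by simp
    next
      case 2
      then show ?thesis
        using fm lpc_sum_left cross_is_lp_fm [OF fm]
        by (auto intro!: lp_tautology simp: erased_Common tautology_def)
    qed
  next
    case (lpc_sum_right l s A t)
    from \<open>l \<in> star_labels h\<close> show ?thesis
    proof (cases rule: star_label_cases)
      case (1 i)
      then show ?thesis
        using lp_cross_sum(2) [of i h t s A] lpc_sum_right fm by simp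
    next
      case 2
      then show ?thesis
        using fm lpc_sum_right cross_is_lp_fm [OF fm]
        by (auto intro!: lp_tautology simp: erased_Common tautology_def)
    qed
  next
    case (lpc_refl i t A)
    then show ?thesis
      using lp_cross_refl [of i h t A] fm by simp
  next
    case (lpc_bang i t A)
    \<comment> \<open>\<open>Bang i t\<close> is erased exactly when \<open>t\<close> is, so the
      axiom either keeps its form or collapses to an implication from \<open>cross h A\<close> to
      itself.\<close>
    show ?thesis
    proof (cases "erased h t")
      case True
      then show ?thesis
        using lpc_bang cross_is_lp_fm [OF fm]
        by (auto intro!: lp_tautology simp: tautology_def)
    next
      case False
      then show ?thesis
        using lpc_bang cross_is_lp_fm [OF fm]
        by (auto intro!: lp_ax lp_schema.lp_bang simp: lp_axiom_def)
    qed
  next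
    case (lpc_tuple ts A)
    then show ?thesis
      using lp_cross_tuple [OF h, of ts A] fm by simp
  \<comment> \<open>Projection, head, tail and induction remain. All their terms are erased, so the
    first three become \<open>A \<rightarrow> A\<close> and the last
    \<open>A \<and> (A \<rightarrow> A) \<rightarrow> A\<close>, up to translation.\<close>
  qed (use fm cross_is_lp_fm [OF fm] in
    \<open>auto intro!: lp_tautology simp: erased_Proj erased_Everyone erased_Common tautology_def\<close>)
qed

section \<open>Translated derivations\<close>

lemma lp_provable_cross:
  assumes h: "h \<ge> 1" and CS: "constant_specification h CS"
    and "lpc_provable h CS A"
  shows "lp_provable h (cross h ` CS) (cross h A)"
  using assms(3)
proof induction
  case (lpc_ax A)
  with h show ?case
    by (rule lp_provable_cross_axiom)
next
  case (lpc_mp A B)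
  then show ?case
    by (auto intro: lp_mp)
next
  case (lpc_nec l n A)
  \<comment> \<open>For the labels \<open>Everyone\<close> and \<open>Common\<close> the constant
    disappears, and the translation of \<open>A\<close> itself has to be derived.\<close>
  have A: "lpc_axiom h A"
    using CS lpc_nec unfolding constant_specification_def by fastforce
  from \<open>l \<in> labels h\<close> show ?case
  proof (cases rule: label_cases)
    case (1 i)
    then have "cross h (Just l (Const l n) A) = Just (Agent i) (Const (Agent i) n) (cross h A)"
      by simp
    with 1 lpc_nec show ?thesis
      by (metis image_eqI lp_nec)
  next
    case 2
    with lpc_nec lp_provable_cross_axiom [OF h A] show ?thesis
      by (simp add: erased_Everyone)
  next
    case 3
    with lpc_nec lp_provable_cross_axiom [OF h A] show ?thesis
      by (simp add: erased_Common)
  qed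
qed

theorem theorem3:
  fixes h :: nat and CS :: "('p::countable) fm set" and A :: "'p fm"
  assumes "h \<ge> 1"
    and "constant_specification h CS"
    and "is_lp_fm h A"
    and "lpc_provable h CS A"
  shows "lp_provable h (cross h ` CS) A"
  using lp_provable_cross [OF assms(1,2,4)] assms(3) by (simp add: cross_id)

end
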